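(* Let $(A,\mu,\Delta,\alpha,R)$ be a cobraided Hom-bialgebra over $\mathbf{k}$. Then for all $x,y,z\in A$ we have $$\sum R(x_1\otimes\alpha(y_1))\,R(x_2\otimes\alpha(z_1))\,R(y_2\otimes z_2)=\sum R(y_1\otimes z_1)\,R(x_1\otimes\alpha(z_2))\,R(x_2\otimes\alpha(y_2))$$ and $$\sum R(x_1\otimes y_1)\,R(\alpha(x_2)\otimes z_1)\,R(\alpha(y_2)\otimes z_2)=\sum R(\alpha(y_1)\otimes z_1)\,R(\alpha(x_1)\otimes z_2)\,R(x_2\otimes y_2).$$
   Context: $\mathbf{k}$ is a fixed associative and commutative ring of characteristic $0$; modules, tensor products and linear maps are over $\mathbf{k}$. $\tau$ is the twist $\tau(v\otimes w)=w\otimes v$. For a map $\Delta\colon A\to A^{\otimes 2}$ write (Sweedler) $\Delta(x)=\sum x_1\otimes x_2$; $\mu(x,y)$ is written $xy$. A Hom-associative algebra $(A,\mu,\alpha)$: a $\mathbf{k}$-module $A$, a bilinear map $\mu\colon A^{\otimes 2}\to A$, a linear map $\alpha\colon A\to A$ with $\alpha\circ\mu=\mu\circ\alpha^{\otimes 2}$ and $\mu\circ(\alpha\otimes\mu)=\mu\circ(\mu\otimes\alpha)$. A Hom-coassociative coalgebra $(C,\Delta,\alpha)$: a $\mathbf{k}$-module $C$, linear maps $\Delta\colon C\to C^{\otimes 2}$, $\alpha\colon C\to C$ with $\alpha^{\otimes 2}\circ\Delta=\Delta\circ\alpha$ and $(\alpha\otimes\Delta)\circ\Delta=(\Delta\otimes\alpha)\circ\Delta$.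 A Hom-bialgebra $(A,\mu,\Delta,\alpha)$: $(A,\mu,\alpha)$ is a Hom-associative algebra, $(A,\Delta,\alpha)$ is a Hom-coassociative coalgebra, and $\Delta(ab)=\sum a_1b_1\otimes a_2b_2$ for all $a,b\in A$. No unit or counit is required. A cobraided Hom-bialgebra $(A,\mu,\Delta,\alpha,R)$: a Hom-bialgebra $(A,\mu,\Delta,\alpha)$ with a bilinear form $R\in\mathrm{Hom}(A^{\otimes 2},\mathbf{k})$ such that for all $x,y,z\in A$: (1) $R(xy\otimes\alpha(z))=\sum R(\alpha(x)\otimes z_1)R(\alpha(y)\otimes z_2)$; (2) $R(\alpha(x)\otimes yz)=\sum R(x_1\otimes\alpha(z))R(x_2\otimes\alpha(y))$; (3) $\sum y_1x_1R(x_2\otimes y_2)=\sum R(x_1\otimes y_1)x_2y_2$. *)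

theory Defs
  imports "HOL-Algebra.Module" "HOL-Algebra.AbelCoset"
begin

section \<open>Modules over a commutative ring\<close>

text \<open>HOL-Algebra provides modules and submodules as records with explicit carriers, but neither
  linear maps, free modules, quotient modules nor tensor products; these are set up here. The
  \<open>mult\<close> and \<open>one\<close> fields of a module record carry no meaning.\<close>

definition char_zero_ring :: "('k, 'r) ring_scheme \<Rightarrow> bool" where
  "char_zero_ring K \<longleftrightarrow> cring K \<and> (\<forall>n::nat. 0 < n \<longrightarrow> [n] \<cdot>\<^bsub>K\<^esub> \<one>\<^bsub>K\<^esub> \<noteq> \<zero>\<^bsub>K\<^esub>)"

definition linear_map ::
  "('k, 'r) ring_scheme \<Rightarrow> ('k, 'a, 'm) module_scheme \<Rightarrow> ('k, 'b, 'n) module_scheme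
    \<Rightarrow> ('a \<Rightarrow> 'b) \<Rightarrow> bool" where
  "linear_map K M N f \<longleftrightarrow> f \<in> carrier M \<rightarrow> carrier N \<and>
     (\<forall>x\<in>carrier M. \<forall>y\<in>carrier M. f (x \<oplus>\<^bsub>M\<^esub> y) = f x \<oplus>\<^bsub>N\<^esub> f y) \<and>
     (\<forall>c\<in>carrier K. \<forall>x\<in>carrier M. f (c \<odot>\<^bsub>M\<^esub> x) = c \<odot>\<^bsub>N\<^esub> f x)"

definition bilinear_map ::
  "('k, 'r) ring_scheme \<Rightarrow> ('k, 'a, 'm) module_scheme \<Rightarrow> ('k, 'b, 'n) module_scheme
    \<Rightarrow> ('k, 'c, 'p) module_scheme \<Rightarrow> ('a \<Rightarrow> 'b \<Rightarrow> 'c) \<Rightarrow> bool" where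
  "bilinear_map K M N P f \<longleftrightarrow>
     (\<forall>x\<in>carrier M. linear_map K N P (f x)) \<and> (\<forall>y\<in>carrier N. linear_map K M P (\<lambda>x. f x y))"

definition ring_as_module :: "('k, 'r) ring_scheme \<Rightarrow> ('k, 'k) module" where
  "ring_as_module K = \<lparr>carrier = carrier K, mult = mult K, one = \<one>\<^bsub>K\<^esub>,
     zero = \<zero>\<^bsub>K\<^esub>, add = add K, smult = mult K\<rparr>"

text \<open>The free module on \<open>B\<close>: finitely supported functions vanishing outside \<open>B\<close>.\<close>

definition free_module :: "('k, 'r) ring_scheme \<Rightarrow> 'b set \<Rightarrow> ('k, 'b \<Rightarrow> 'k) module" where
  "free_module K B = \<lparr>
     carrier = {p. range p \<subseteq> carrier K \<and> finite {b. p b \<noteq> \<zero>\<^bsub>K\<^esub>} \<and> {b. p b \<noteq> \<zero>\<^bsub>K\<^esub>} \<subseteq> B},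
     mult = undefined, one = undefined,
     zero = (\<lambda>_. \<zero>\<^bsub>K\<^esub>), add = (\<lambda>p q b. p b \<oplus>\<^bsub>K\<^esub> q b), smult = (\<lambda>c p b. c \<otimes>\<^bsub>K\<^esub> p b)\<rparr>"

definition free_gen :: "('k, 'r) ring_scheme \<Rightarrow> 'b \<Rightarrow> 'b \<Rightarrow> 'k" where
  "free_gen K b = (\<lambda>b'. if b' = b then \<one>\<^bsub>K\<^esub> else \<zero>\<^bsub>K\<^esub>)"

definition generated_submodule ::
  "('k, 'r) ring_scheme \<Rightarrow> ('k, 'a, 'm) module_scheme \<Rightarrow> 'a set \<Rightarrow> 'a set" where
  "generated_submodule K M S = \<Inter>{H. submodule H K M \<and> S \<subseteq> H}"

definition quotient_module ::
  "('k, 'a, 'm) module_scheme \<Rightarrow> 'a set \<Rightarrow> ('k, 'a set) module" where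
  "quotient_module M H = \<lparr>carrier = a_rcosets\<^bsub>M\<^esub> H, mult = undefined, one = undefined,
     zero = H, add = set_add M, smult = (\<lambda>c X. \<Union>x\<in>X. H +>\<^bsub>M\<^esub> (c \<odot>\<^bsub>M\<^esub> x))\<rparr>"


section \<open>Tensor products\<close>

definition tensor_relations ::
  "('k, 'r) ring_scheme \<Rightarrow> ('k, 'a, 'm) module_scheme \<Rightarrow> ('k, 'b, 'n) module_scheme
    \<Rightarrow> ('a \<times> 'b \<Rightarrow> 'k) set" where
  "tensor_relations K M N = (let F = free_module K (carrier M \<times> carrier N); g = free_gen K in
     {g (x \<oplus>\<^bsub>M\<^esub> x', y) \<ominus>\<^bsub>F\<^esub> (g (x, y) \<oplus>\<^bsub>F\<^esub> g (x', y)) | x x' y.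
        x \<in> carrier M \<and> x' \<in> carrier M \<and> y \<in> carrier N} \<union>
     {g (x, y \<oplus>\<^bsub>N\<^esub> y') \<ominus>\<^bsub>F\<^esub> (g (x, y) \<oplus>\<^bsub>F\<^esub> g (x, y')) | x y y'.
        x \<in> carrier M \<and> y \<in> carrier N \<and> y' \<in> carrier N} \<union>
     {g (c \<odot>\<^bsub>M\<^esub> x, y) \<ominus>\<^bsub>F\<^esub> c \<odot>\<^bsub>F\<^esub> g (x, y) | c x y.
        c \<in> carrier K \<and> x \<in> carrier M \<and> y \<in> carrier N} \<union>
     {g (x, c \<odot>\<^bsub>N\<^esub> y) \<ominus>\<^bsub>F\<^esub> c \<odot>\<^bsub>F\<^esub> g (x, y) | c x y.
        c \<in> carrier K \<and> x \<in> carrier M \<and> y \<in> carrier N})"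

definition tensor_kernel ::
  "('k, 'r) ring_scheme \<Rightarrow> ('k, 'a, 'm) module_scheme \<Rightarrow> ('k, 'b, 'n) module_scheme
    \<Rightarrow> ('a \<times> 'b \<Rightarrow> 'k) set" where
  "tensor_kernel K M N = generated_submodule K (free_module K (carrier M \<times> carrier N))
     (tensor_relations K M N)"

definition tensor_product ::
  "('k, 'r) ring_scheme \<Rightarrow> ('k, 'a, 'm) module_scheme \<Rightarrow> ('k, 'b, 'n) module_scheme
    \<Rightarrow> ('k, ('a \<times> 'b \<Rightarrow> 'k) set) module" where
  "tensor_product K M N =
     quotient_module (free_module K (carrier M \<times> carrier N)) (tensor_kernel K M N)"

definition pure_tensor ::
  "('k, 'r) ring_scheme \<Rightarrow> ('k, 'a, 'm) module_scheme \<Rightarrow> ('k, 'b, 'n) module_scheme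
    \<Rightarrow> 'a \<Rightarrow> 'b \<Rightarrow> ('a \<times> 'b \<Rightarrow> 'k) set" where
  "pure_tensor K M N x y =
     tensor_kernel K M N +>\<^bsub>free_module K (carrier M \<times> carrier N)\<^esub> free_gen K (x, y)"

text \<open>For \<open>f\<close> bilinear on \<open>M\<close> and \<open>N\<close> with values in \<open>P\<close>, the linear map on the tensor product
  that \<open>f\<close> induces. The image of a coset under the linear extension of \<open>f\<close> to the free module is
  then a singleton, as in the library's treatment of maps out of a factor group. In Sweedler
  notation, if \<open>\<Delta> x = \<Sum> x\<^sub>1 \<otimes> x\<^sub>2\<close> then \<open>tensor_lift K P f (\<Delta> x)\<close> is \<open>\<Sum> f x\<^sub>1 x\<^sub>2\<close>.\<close>

definition tensor_lift ::
  "('k, 'r) ring_scheme \<Rightarrow> ('k, 'c, 'p) module_scheme \<Rightarrow> ('a \<Rightarrow> 'b \<Rightarrow> 'c)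
    \<Rightarrow> ('a \<times> 'b \<Rightarrow> 'k) set \<Rightarrow> 'c" where
  "tensor_lift K P f T = the_elem
     ((\<lambda>p. \<Oplus>\<^bsub>P\<^esub>b\<in>{b. p b \<noteq> \<zero>\<^bsub>K\<^esub>}. p b \<odot>\<^bsub>P\<^esub> f (fst b) (snd b)) ` T)"

text \<open>\<open>f \<otimes> g\<close>, with values in \<open>M \<otimes> N\<close>.\<close>

definition tensor_map ::
  "('k, 'r) ring_scheme \<Rightarrow> ('k, 'c, 'm) module_scheme \<Rightarrow> ('k, 'd, 'n) module_scheme
    \<Rightarrow> ('a \<Rightarrow> 'c) \<Rightarrow> ('b \<Rightarrow> 'd) \<Rightarrow> ('a \<times> 'b \<Rightarrow> 'k) set \<Rightarrow> ('c \<times> 'd \<Rightarrow> 'k) set" where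
  "tensor_map K M N f g =
     tensor_lift K (tensor_product K M N) (\<lambda>x y. pure_tensor K M N (f x) (g y))"

text \<open>The canonical isomorphism from \<open>(L \<otimes> M) \<otimes> N\<close> to \<open>L \<otimes> (M \<otimes> N)\<close>.\<close>

definition tensor_assoc ::
  "('k, 'r) ring_scheme \<Rightarrow> ('k, 'a, 'l) module_scheme \<Rightarrow> ('k, 'b, 'm) module_scheme
    \<Rightarrow> ('k, 'c, 'n) module_scheme
    \<Rightarrow> (('a \<times> 'b \<Rightarrow> 'k) set \<times> 'c \<Rightarrow> 'k) set \<Rightarrow> ('a \<times> ('b \<times> 'c \<Rightarrow> 'k) set \<Rightarrow> 'k) set" where
  "tensor_assoc K L M N =
     (let MN = tensor_product K M N; P = tensor_product K L MN in
      tensor_lift K P (\<lambda>t z. tensor_lift K P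
        (\<lambda>x y. pure_tensor K L MN x (pure_tensor K M N y z)) t))"


section \<open>Cobraided Hom-bialgebras\<close>

locale hom_associative_algebra = module K A
  for K :: "('k, 'r) ring_scheme" and A :: "('k, 'a, 'm) module_scheme" +
  fixes \<mu> :: "'a \<Rightarrow> 'a \<Rightarrow> 'a" and \<alpha> :: "'a \<Rightarrow> 'a"
  assumes mu_bilinear: "bilinear_map K A A A \<mu>"
    and alpha_linear: "linear_map K A A \<alpha>"
    and alpha_mu: "\<lbrakk>x \<in> carrier A; y \<in> carrier A\<rbrakk> \<Longrightarrow> \<alpha> (\<mu> x y) = \<mu> (\<alpha> x) (\<alpha> y)"
    and hom_assoc: "\<lbrakk>x \<in> carrier A; y \<in> carrier A; z \<in> carrier A\<rbrakk>
      \<Longrightarrow> \<mu> (\<alpha> x) (\<mu> y z) = \<mu> (\<mu> x y) (\<alpha> z)"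

locale hom_coassociative_coalgebra = module K C
  for K :: "('k, 'r) ring_scheme" and C :: "('k, 'a, 'm) module_scheme" +
  fixes \<Delta> :: "'a \<Rightarrow> ('a \<times> 'a \<Rightarrow> 'k) set" and \<alpha> :: "'a \<Rightarrow> 'a"
  assumes Delta_linear: "linear_map K C (tensor_product K C C) \<Delta>"
    and alpha_linear: "linear_map K C C \<alpha>"
    and alpha_Delta: "x \<in> carrier C \<Longrightarrow> tensor_map K C C \<alpha> \<alpha> (\<Delta> x) = \<Delta> (\<alpha> x)"
    and hom_coassoc: "x \<in> carrier C \<Longrightarrow>
      tensor_map K C (tensor_product K C C) \<alpha> \<Delta> (\<Delta> x) =
      tensor_assoc K C C C (tensor_map K (tensor_product K C C) C \<Delta> \<alpha> (\<Delta> x))"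

locale hom_bialgebra =
  hom_associative_algebra K A \<mu> \<alpha> + hom_coassociative_coalgebra K A \<Delta> \<alpha>
  for K :: "('k, 'r) ring_scheme" and A :: "('k, 'a, 'm) module_scheme"
    and \<mu> :: "'a \<Rightarrow> 'a \<Rightarrow> 'a" and \<Delta> :: "'a \<Rightarrow> ('a \<times> 'a \<Rightarrow> 'k) set" and \<alpha> :: "'a \<Rightarrow> 'a" +
  assumes Delta_mu: "\<lbrakk>a \<in> carrier A; b \<in> carrier A\<rbrakk> \<Longrightarrow>
    \<Delta> (\<mu> a b) = tensor_lift K (tensor_product K A A) (\<lambda>a\<^sub>1 a\<^sub>2.
      tensor_lift K (tensor_product K A A) (\<lambda>b\<^sub>1 b\<^sub>2.
        pure_tensor K A A (\<mu> a\<^sub>1 b\<^sub>1) (\<mu> a\<^sub>2 b\<^sub>2)) (\<Delta> b)) (\<Delta> a)"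

abbreviation scalar_sweedler ::
  "('k, 'r) ring_scheme \<Rightarrow> ('a \<Rightarrow> 'b \<Rightarrow> 'k) \<Rightarrow> ('a \<times> 'b \<Rightarrow> 'k) set \<Rightarrow> 'k" where
  "scalar_sweedler K \<equiv> tensor_lift K (ring_as_module K)"

locale cobraided_hom_bialgebra = hom_bialgebra K A \<mu> \<Delta> \<alpha>
  for K :: "('k, 'r) ring_scheme" and A :: "('k, 'a, 'm) module_scheme"
    and \<mu> :: "'a \<Rightarrow> 'a \<Rightarrow> 'a" and \<Delta> :: "'a \<Rightarrow> ('a \<times> 'a \<Rightarrow> 'k) set" and \<alpha> :: "'a \<Rightarrow> 'a" +
  fixes R :: "'a \<Rightarrow> 'a \<Rightarrow> 'k"
  assumes R_bilinear: "bilinear_map K A A (ring_as_module K) R"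
    and R_mu_left: "\<lbrakk>x \<in> carrier A; y \<in> carrier A; z \<in> carrier A\<rbrakk> \<Longrightarrow>
      R (\<mu> x y) (\<alpha> z) =
        scalar_sweedler K (\<lambda>z\<^sub>1 z\<^sub>2. R (\<alpha> x) z\<^sub>1 \<otimes>\<^bsub>K\<^esub> R (\<alpha> y) z\<^sub>2) (\<Delta> z)"
    and R_mu_right: "\<lbrakk>x \<in> carrier A; y \<in> carrier A; z \<in> carrier A\<rbrakk> \<Longrightarrow>
      R (\<alpha> x) (\<mu> y z) =
        scalar_sweedler K (\<lambda>x\<^sub>1 x\<^sub>2. R x\<^sub>1 (\<alpha> z) \<otimes>\<^bsub>K\<^esub> R x\<^sub>2 (\<alpha> y)) (\<Delta> x)"
    and R_commute: "\<lbrakk>x \<in> carrier A; y \<in> carrier A\<rbrakk> \<Longrightarrow>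
      tensor_lift K A (\<lambda>x\<^sub>1 x\<^sub>2. tensor_lift K A (\<lambda>y\<^sub>1 y\<^sub>2.
        R x\<^sub>2 y\<^sub>2 \<odot>\<^bsub>A\<^esub> \<mu> y\<^sub>1 x\<^sub>1) (\<Delta> y)) (\<Delta> x) =
      tensor_lift K A (\<lambda>x\<^sub>1 x\<^sub>2. tensor_lift K A (\<lambda>y\<^sub>1 y\<^sub>2.
        R x\<^sub>1 y\<^sub>1 \<odot>\<^bsub>A\<^esub> \<mu> x\<^sub>2 y\<^sub>2) (\<Delta> y)) (\<Delta> x)"

end

theory Submission
  imports Defs
begin

text \<open>Both equations are images of the commutation rule
  \<open>\<Sum> y\<^sub>1 x\<^sub>1 R(x\<^sub>2 \<otimes> y\<^sub>2) = \<Sum> R(x\<^sub>1 \<otimes> y\<^sub>1) x\<^sub>2 y\<^sub>2\<close> under linear forms. For the first equation, apply the rule to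
  \<open>y\<close> and \<open>z\<close> and then the form \<open>R(\<alpha>(x) \<otimes> -)\<close>. Its left side becomes
  \<open>\<Sum> R(\<alpha>(x) \<otimes> z\<^sub>1 y\<^sub>1) R(y\<^sub>2 \<otimes> z\<^sub>2)\<close>, and multiplicativity of \<open>R\<close> in the second argument turns
  \<open>R(\<alpha>(x) \<otimes> z\<^sub>1 y\<^sub>1)\<close> into \<open>\<Sum> R(x\<^sub>1 \<otimes> \<alpha>(y\<^sub>1)) R(x\<^sub>2 \<otimes> \<alpha>(z\<^sub>1))\<close>; likewise its right side becomes the
  right side of the equation. For the second equation, apply the rule to \<open>x\<close> and \<open>y\<close>, the form
  \<open>R(- \<otimes> \<alpha>(z))\<close>, and multiplicativity in the first argument
  (\<open>yang_baxter_from_R_mu_right\<close>, \<open>yang_baxter_from_R_mu_left\<close>).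

  The bulk of the text makes such Sweedler computations legitimate for \<open>tensor_lift\<close>. Everything rests
  on \<open>tensor_lift_eq_finsum\<close>: a tensor is the coset of some finitely supported \<open>p\<close>, and for every
  bilinear \<open>f\<close> the value of \<open>tensor_lift\<close> is the finite sum of \<open>f\<close> weighted by that same \<open>p\<close>. The
  representative does not depend on \<open>f\<close> or its codomain, so linear maps can be moved through such a
  sum (\<open>linear_map_tensor_lift\<close>), sums over two tensors can be interchanged
  (\<open>tensor_lift_swap\<close>), and a sum over one tensor is bilinear in further arguments of the integrand
  (\<open>bilinear_map_tensor_lift\<close>).\<close>

section \<open>Linear and bilinear maps\<close>

lemma linear_mapI:
  assumes "\<And>x. x \<in> carrier M \<Longrightarrow> f x \<in> carrier N"
    and "\<And>x y. \<lbrakk>x \<in> carrier M; y \<in> carrier M\<rbrakk> \<Longrightarrow> f (x \<oplus>\<^bsub>M\<^esub> y) = f x \<oplus>\<^bsub>N\<^esub> f y"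
    and "\<And>c x. \<lbrakk>c \<in> carrier K; x \<in> carrier M\<rbrakk> \<Longrightarrow> f (c \<odot>\<^bsub>M\<^esub> x) = c \<odot>\<^bsub>N\<^esub> f x"
  shows "linear_map K M N f"
  using assms unfolding linear_map_def by auto

lemma linear_mapD:
  assumes "linear_map K M N f"
  shows "x \<in> carrier M \<Longrightarrow> f x \<in> carrier N"
    and "\<lbrakk>x \<in> carrier M; y \<in> carrier M\<rbrakk> \<Longrightarrow> f (x \<oplus>\<^bsub>M\<^esub> y) = f x \<oplus>\<^bsub>N\<^esub> f y"
    and "\<lbrakk>c \<in> carrier K; x \<in> carrier M\<rbrakk> \<Longrightarrow> f (c \<odot>\<^bsub>M\<^esub> x) = c \<odot>\<^bsub>N\<^esub> f x"
  using assms unfolding linear_map_def by auto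

lemma bilinear_mapI:
  assumes "\<And>x. x \<in> carrier M \<Longrightarrow> linear_map K N P (f x)"
    and "\<And>y. y \<in> carrier N \<Longrightarrow> linear_map K M P (\<lambda>x. f x y)"
  shows "bilinear_map K M N P f"
  using assms unfolding bilinear_map_def by auto

lemma bilinear_mapD:
  assumes "bilinear_map K M N P f"
  shows "x \<in> carrier M \<Longrightarrow> linear_map K N P (f x)"
    and "y \<in> carrier N \<Longrightarrow> linear_map K M P (\<lambda>x. f x y)"
    and "\<lbrakk>x \<in> carrier M; y \<in> carrier N\<rbrakk> \<Longrightarrow> f x y \<in> carrier P"
  using assms unfolding bilinear_map_def linear_map_def by auto

lemma linear_map_zero:
  assumes "module K M" "module K N" "linear_map K M N h"
  shows "h \<zero>\<^bsub>M\<^esub> = \<zero>\<^bsub>N\<^esub>"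
proof -
  interpret M: module K M by fact
  interpret N: module K N by fact
  have "h (\<zero>\<^bsub>K\<^esub> \<odot>\<^bsub>M\<^esub> \<zero>\<^bsub>M\<^esub>) = \<zero>\<^bsub>K\<^esub> \<odot>\<^bsub>N\<^esub> h \<zero>\<^bsub>M\<^esub>"
    using linear_mapD[OF assms(3)] by blast
  then show ?thesis
    using linear_mapD(1)[OF assms(3)] by simp
qed

lemma linear_map_finsum:
  assumes "module K M" "module K N" "linear_map K M N h"
    and "finite S" "\<And>s. s \<in> S \<Longrightarrow> g s \<in> carrier M"
  shows "h (\<Oplus>\<^bsub>M\<^esub>s\<in>S. g s) = (\<Oplus>\<^bsub>N\<^esub>s\<in>S. h (g s))"
proof -
  interpret M: module K M by fact
  interpret N: module K N by fact
  note h = linear_mapD[OF assms(3)]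
  show ?thesis
    using assms(4,5)
  proof (induction S)
    case empty
    show ?case using linear_map_zero[OF assms(1-3)] by simp
  next
    case (insert s S)
    then show ?case using h by (simp add: Pi_iff)
  qed
qed

lemma ring_as_module_simps [simp]:
  "carrier (ring_as_module K) = carrier K" "\<zero>\<^bsub>ring_as_module K\<^esub> = \<zero>\<^bsub>K\<^esub>"
  "add (ring_as_module K) = add K" "smult (ring_as_module K) = mult K"
  by (simp_all add: ring_as_module_def)

lemma module_ring_as_module:
  assumes "cring K"
  shows "module K (ring_as_module K)"
proof -
  interpret cring K by fact
  show ?thesis
    by (intro moduleI abelian_groupI)
      (use add.inv_closed l_neg in \<open>auto simp: a_ac m_ac l_distr r_distr assms\<close>)
qed

section \<open>The free module\<close>

lemma free_module_simps [simp]: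
  "\<zero>\<^bsub>free_module K B\<^esub> = (\<lambda>_. \<zero>\<^bsub>K\<^esub>)"
  "p \<oplus>\<^bsub>free_module K B\<^esub> q = (\<lambda>b. p b \<oplus>\<^bsub>K\<^esub> q b)"
  "c \<odot>\<^bsub>free_module K B\<^esub> p = (\<lambda>b. c \<otimes>\<^bsub>K\<^esub> p b)"
  by (simp_all add: free_module_def)

lemma free_module_carrier:
  "p \<in> carrier (free_module K B) \<longleftrightarrow>
     (\<forall>b. p b \<in> carrier K) \<and> finite {b. p b \<noteq> \<zero>\<^bsub>K\<^esub>} \<and> {b. p b \<noteq> \<zero>\<^bsub>K\<^esub>} \<subseteq> B"
  by (auto simp: free_module_def)

lemma module_free_module:
  assumes "cring K"
  shows "module K (free_module K B)"
proof -
  interpret cring K by fact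
  let ?F = "free_module K B"
  have add: "p \<oplus>\<^bsub>?F\<^esub> q \<in> carrier ?F" if "p \<in> carrier ?F" "q \<in> carrier ?F" for p q
  proof -
    have "{b. p b \<oplus>\<^bsub>K\<^esub> q b \<noteq> \<zero>\<^bsub>K\<^esub>} \<subseteq> {b. p b \<noteq> \<zero>\<^bsub>K\<^esub>} \<union> {b. q b \<noteq> \<zero>\<^bsub>K\<^esub>}"
      by auto
    moreover have "finite \<dots>" "\<dots> \<subseteq> B"
      using that by (auto simp: free_module_carrier)
    ultimately show ?thesis
      using that finite_subset unfolding free_module_carrier free_module_simps by blast
  qed
  have smult: "c \<odot>\<^bsub>?F\<^esub> p \<in> carrier ?F" if "c \<in> carrier K" "p \<in> carrier ?F" for c p
    using that unfolding free_module_carrier free_module_simps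
    by (auto elim!: finite_subset[rotated])
  show ?thesis
  proof (intro moduleI abelian_groupI)
    show "\<exists>q\<in>carrier ?F. q \<oplus>\<^bsub>?F\<^esub> p = \<zero>\<^bsub>?F\<^esub>" if p: "p \<in> carrier ?F" for p
    proof
      show "(\<ominus>\<^bsub>K\<^esub> \<one>\<^bsub>K\<^esub>) \<odot>\<^bsub>?F\<^esub> p \<in> carrier ?F"
        using p by (intro smult) auto
      show "(\<ominus>\<^bsub>K\<^esub> \<one>\<^bsub>K\<^esub>) \<odot>\<^bsub>?F\<^esub> p \<oplus>\<^bsub>?F\<^esub> p = \<zero>\<^bsub>?F\<^esub>"
        using p by (auto simp: free_module_carrier l_minus l_neg)
    qed
  qed (use add smult in \<open>auto simp: assms free_module_carrier a_ac m_ac l_distr r_distr\<close>)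
qed

lemma free_gen_in_carrier:
  assumes "cring K" "b \<in> B"
  shows "free_gen K b \<in> carrier (free_module K B)"
proof -
  interpret cring K by fact
  show ?thesis
    using assms(2) by (auto simp: free_module_carrier free_gen_def elim!: finite_subset[rotated])
qed

text \<open>The linear extension of \<open>f\<close> from the basis \<open>B\<close> to the free module on \<open>B\<close>; the set \<open>B\<close> itself is not
  a parameter, since the sum ranges over the support.\<close>

definition free_extension ::
  "('k, 'r) ring_scheme \<Rightarrow> ('k, 'c, 'p) module_scheme \<Rightarrow> ('b \<Rightarrow> 'c) \<Rightarrow> ('b \<Rightarrow> 'k) \<Rightarrow> 'c" where
  "free_extension K P f p = (\<Oplus>\<^bsub>P\<^esub>b\<in>{b. p b \<noteq> \<zero>\<^bsub>K\<^esub>}. p b \<odot>\<^bsub>P\<^esub> f b)"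

text \<open>Two elements of the free module have different supports, so additivity needs a sum over a common
  larger set.\<close>

lemma free_extension_superset:
  assumes "module K P" "p \<in> carrier (free_module K B)" "\<And>b. b \<in> B \<Longrightarrow> f b \<in> carrier P"
    and "finite S" "{b. p b \<noteq> \<zero>\<^bsub>K\<^esub>} \<subseteq> S" "S \<subseteq> B"
  shows "free_extension K P f p = (\<Oplus>\<^bsub>P\<^esub>b\<in>S. p b \<odot>\<^bsub>P\<^esub> f b)"
proof -
  interpret P: module K P by fact
  show ?thesis
    unfolding free_extension_def
    using assms by (intro P.add.finprod_mono_neutral_cong_left) (auto simp: free_module_carrier Pi_iff)
qed

lemma free_extension_linear:
  assumes "module K P" "\<And>b. b \<in> B \<Longrightarrow> f b \<in> carrier P"
  shows "linear_map K (free_module K B) P (free_extension K P f)"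
proof -
  interpret P: module K P by fact
  let ?F = "free_module K B"
  interpret F: module K ?F by (rule module_free_module) (rule P.is_cring)
  have superset: "free_extension K P f p = (\<Oplus>\<^bsub>P\<^esub>b\<in>S. p b \<odot>\<^bsub>P\<^esub> f b)"
    if "p \<in> carrier ?F" "finite S" "{b. p b \<noteq> \<zero>\<^bsub>K\<^esub>} \<subseteq> S" "S \<subseteq> B" for p S
    using that assms by (intro free_extension_superset)
  show ?thesis
  proof (rule linear_mapI)
    fix p assume p: "p \<in> carrier ?F"
    then show "free_extension K P f p \<in> carrier P"
      using assms unfolding free_extension_def
      by (intro P.finsum_closed) (auto simp: free_module_carrier Pi_iff)
    fix q assume q: "q \<in> carrier ?F"
    let ?S = "{b. p b \<noteq> \<zero>\<^bsub>K\<^esub>} \<union> {b. q b \<noteq> \<zero>\<^bsub>K\<^esub>}"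
    have S: "finite ?S" "?S \<subseteq> B"
      using p q by (auto simp: free_module_carrier)
    have "{b. (p \<oplus>\<^bsub>?F\<^esub> q) b \<noteq> \<zero>\<^bsub>K\<^esub>} \<subseteq> ?S"
      by auto
    then have "free_extension K P f (p \<oplus>\<^bsub>?F\<^esub> q) = (\<Oplus>\<^bsub>P\<^esub>b\<in>?S. (p b \<oplus>\<^bsub>K\<^esub> q b) \<odot>\<^bsub>P\<^esub> f b)"
      using superset[OF F.a_closed[OF p q] S(1) _ S(2)] by simp
    also have "\<dots> = (\<Oplus>\<^bsub>P\<^esub>b\<in>?S. p b \<odot>\<^bsub>P\<^esub> f b \<oplus>\<^bsub>P\<^esub> q b \<odot>\<^bsub>P\<^esub> f b)"
      using p q S assms
      by (intro P.finsum_cong') (auto simp: free_module_carrier P.smult_l_distr Pi_iff subset_iff)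
    also have "\<dots> = (\<Oplus>\<^bsub>P\<^esub>b\<in>?S. p b \<odot>\<^bsub>P\<^esub> f b) \<oplus>\<^bsub>P\<^esub> (\<Oplus>\<^bsub>P\<^esub>b\<in>?S. q b \<odot>\<^bsub>P\<^esub> f b)"
      using p q S assms
      by (intro P.finsum_addf) (auto simp: free_module_carrier Pi_iff subset_iff)
    also have "\<dots> = free_extension K P f p \<oplus>\<^bsub>P\<^esub> free_extension K P f q"
      using superset[OF p, where S = ?S] superset[OF q, where S = ?S] S by auto
    finally show "free_extension K P f (p \<oplus>\<^bsub>?F\<^esub> q)
      = free_extension K P f p \<oplus>\<^bsub>P\<^esub> free_extension K P f q" .
  next
    fix c p assume c: "c \<in> carrier K" and p: "p \<in> carrier ?F"
    let ?S = "{b. p b \<noteq> \<zero>\<^bsub>K\<^esub>}"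
    have S: "finite ?S" "?S \<subseteq> B"
      using p by (auto simp: free_module_carrier)
    have cp: "c \<odot>\<^bsub>?F\<^esub> p \<in> carrier ?F"
      using c p by (rule F.smult_closed)
    have "{b. (c \<odot>\<^bsub>?F\<^esub> p) b \<noteq> \<zero>\<^bsub>K\<^esub>} \<subseteq> ?S"
      using c by auto
    then have "free_extension K P f (c \<odot>\<^bsub>?F\<^esub> p) = (\<Oplus>\<^bsub>P\<^esub>b\<in>?S. (c \<otimes>\<^bsub>K\<^esub> p b) \<odot>\<^bsub>P\<^esub> f b)"
      using superset[OF cp S(1) _ S(2)] by simp
    also have "\<dots> = (\<Oplus>\<^bsub>P\<^esub>b\<in>?S. c \<odot>\<^bsub>P\<^esub> (p b \<odot>\<^bsub>P\<^esub> f b))"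
      using p c S assms
      by (intro P.finsum_cong') (auto simp: free_module_carrier P.smult_assoc1 Pi_iff subset_iff)
    also have "\<dots> = c \<odot>\<^bsub>P\<^esub> free_extension K P f p"
      unfolding free_extension_def using p c S assms
      by (intro P.finsum_smult_ldistr[symmetric]) (auto simp: free_module_carrier Pi_iff subset_iff)
    finally show "free_extension K P f (c \<odot>\<^bsub>?F\<^esub> p) = c \<odot>\<^bsub>P\<^esub> free_extension K P f p" .
  qed
qed

lemma free_extension_gen:
  assumes "module K P" "\<And>b. b \<in> B \<Longrightarrow> f b \<in> carrier P" "b \<in> B"
  shows "free_extension K P f (free_gen K b) = f b"
proof -
  interpret P: module K P by fact
  have "free_extension K P f (free_gen K b) = (\<Oplus>\<^bsub>P\<^esub>b'\<in>{b}. free_gen K b b' \<odot>\<^bsub>P\<^esub> f b')"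
    by (rule free_extension_superset[OF assms(1) free_gen_in_carrier[OF P.is_cring assms(3)]])
      (use assms in \<open>auto simp: free_gen_def\<close>)
  also have "\<dots> = f b"
    using assms by (simp add: free_gen_def Pi_iff)
  finally show ?thesis .
qed

lemma submodule_linear_kernel:
  assumes "module K M" "module K N" "linear_map K M N h"
  shows "submodule {p \<in> carrier M. h p = \<zero>\<^bsub>N\<^esub>} K M"
proof -
  interpret M: module K M by fact
  interpret N: module K N by fact
  note h = linear_mapD[OF assms(3)]
  have neg: "h (\<ominus>\<^bsub>M\<^esub> p) = \<ominus>\<^bsub>N\<^esub> h p" if "p \<in> carrier M" for p
  proof -
    have "h (\<ominus>\<^bsub>M\<^esub> p) = h ((\<ominus>\<^bsub>K\<^esub> \<one>\<^bsub>K\<^esub>) \<odot>\<^bsub>M\<^esub> p)"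
      using that by (simp add: M.smult_l_minus)
    also have "\<dots> = \<ominus>\<^bsub>N\<^esub> h p"
      using that h by (simp add: N.smult_l_minus)
    finally show ?thesis .
  qed
  show ?thesis
    by (rule M.submoduleI) (auto simp: linear_map_zero[OF assms] h neg)
qed

lemma linear_map_minus_eq_zero:
  assumes "module K M" "module K N" "linear_map K M N h"
    and "p \<in> carrier M" "q \<in> carrier M" "h p = h q"
  shows "h (p \<ominus>\<^bsub>M\<^esub> q) = \<zero>\<^bsub>N\<^esub>"
proof -
  interpret M: module K M by fact
  interpret N: module K N by fact
  note h = linear_mapD[OF assms(3)]
  have "h p = h ((p \<ominus>\<^bsub>M\<^esub> q) \<oplus>\<^bsub>M\<^esub> q)"
    using assms by (simp add: a_minus_def M.a_assoc M.l_neg)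
  also have "\<dots> = h (p \<ominus>\<^bsub>M\<^esub> q) \<oplus>\<^bsub>N\<^esub> h q"
    using assms h by simp
  finally show ?thesis
    using assms h by (metis M.minus_closed N.add.r_cancel_one)
qed

section \<open>Sums over the components of a tensor\<close>

text \<open>Bilinearity of \<open>f\<close> says exactly that its linear extension vanishes on each of the four families of
  generating relations. The kernel of the extension is a submodule containing them, hence it contains
  the submodule that they generate.\<close>

lemma free_extension_tensor_kernel:
  assumes "module K M" "module K N" "module K P" "bilinear_map K M N P f"
    and "p \<in> tensor_kernel K M N"
  shows "p \<in> carrier (free_module K (carrier M \<times> carrier N))"
    and "free_extension K P (\<lambda>b. f (fst b) (snd b)) p = \<zero>\<^bsub>P\<^esub>"
proof -
  interpret M: module K M by fact
  interpret N: module K N by fact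
  interpret P: module K P by fact
  let ?B = "carrier M \<times> carrier N"
  let ?F = "free_module K ?B"
  let ?f = "\<lambda>b. f (fst b) (snd b)"
  let ?h = "free_extension K P ?f"
  have F: "module K ?F" by (rule module_free_module) (rule M.is_cring)
  interpret F: module K ?F by fact
  note f = bilinear_mapD[OF assms(4)]
  have h: "linear_map K ?F P ?h"
    by (rule free_extension_linear) (use assms f in auto)
  note h' = linear_mapD[OF h]
  have gen: "?h (free_gen K (x, y)) = f x y" if "x \<in> carrier M" "y \<in> carrier N" for x y
    using free_extension_gen[OF assms(3), of ?B ?f "(x, y)"] f that by auto
  have gc: "free_gen K (x, y) \<in> carrier ?F" if "x \<in> carrier M" "y \<in> carrier N" for x y
    using that by (intro free_gen_in_carrier M.is_cring) auto
  note minus = linear_map_minus_eq_zero[OF F assms(3) h]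
  have "tensor_relations K M N \<subseteq> {p \<in> carrier ?F. ?h p = \<zero>\<^bsub>P\<^esub>}"
    unfolding tensor_relations_def Let_def
    using linear_mapD[OF f(1)] linear_mapD[OF f(2)]
    by (auto simp del: free_module_simps
        intro!: minus F.minus_closed gc F.a_closed F.smult_closed simp: h' gen gc)
  then have "tensor_kernel K M N \<subseteq> {p \<in> carrier ?F. ?h p = \<zero>\<^bsub>P\<^esub>}"
    unfolding tensor_kernel_def generated_submodule_def
    using submodule_linear_kernel[OF F assms(3) h] by blast
  then show "p \<in> carrier ?F" "?h p = \<zero>\<^bsub>P\<^esub>"
    using assms(5) by auto
qed

lemma tensor_product_representative:
  assumes "T \<in> carrier (tensor_product K M N)"
  obtains p where "p \<in> carrier (free_module K (carrier M \<times> carrier N))"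
    and "T = tensor_kernel K M N +>\<^bsub>free_module K (carrier M \<times> carrier N)\<^esub> p"
  using assms unfolding tensor_product_def quotient_module_def A_RCOSETS_def'
  by auto

text \<open>The linear extension is constant on the coset, so its image is a singleton and \<open>the_elem\<close> returns
  the value at any chosen representative.\<close>

lemma tensor_lift_eq_free_extension:
  assumes "module K M" "module K N" "module K P" "bilinear_map K M N P f"
    and "p \<in> carrier (free_module K (carrier M \<times> carrier N))"
    and T: "T = tensor_kernel K M N +>\<^bsub>free_module K (carrier M \<times> carrier N)\<^esub> p"
  shows "tensor_lift K P f T = free_extension K P (\<lambda>b. f (fst b) (snd b)) p"
proof -
  interpret P: module K P by fact
  let ?B = "carrier M \<times> carrier N"
  let ?F = "free_module K ?B"
  let ?h = "free_extension K P (\<lambda>b. f (fst b) (snd b))"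
  have F: "module K ?F" by (rule module_free_module) (rule P.is_cring)
  interpret F: module K ?F by fact
  note f = bilinear_mapD[OF assms(4)]
  have h: "linear_map K ?F P ?h"
    by (rule free_extension_linear) (use assms f in auto)
  note h' = linear_mapD[OF h]
  have ne: "\<zero>\<^bsub>?F\<^esub> \<in> tensor_kernel K M N"
    unfolding tensor_kernel_def generated_submodule_def
    using subgroup.one_closed[OF submodule.axioms(1)] by fastforce
  have T': "T = (\<lambda>r. r \<oplus>\<^bsub>?F\<^esub> p) ` tensor_kernel K M N"
    unfolding T a_r_coset_def' by auto
  have "?h (r \<oplus>\<^bsub>?F\<^esub> p) = ?h p" if "r \<in> tensor_kernel K M N" for r
    using free_extension_tensor_kernel[OF assms(1-4) that] h'(2)[of r p] h'(1)[of p] assms(5)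
    by (simp del: free_module_simps)
  then have "?h ` T = {?h p}"
    unfolding T' using ne by (auto simp del: free_module_simps simp: image_image)
  then show ?thesis
    unfolding tensor_lift_def free_extension_def by simp
qed

lemma tensor_lift_eq_finsum:
  assumes "module K M" "module K N" "module K P" "bilinear_map K M N P f"
    and "p \<in> carrier (free_module K (carrier M \<times> carrier N))"
    and "T = tensor_kernel K M N +>\<^bsub>free_module K (carrier M \<times> carrier N)\<^esub> p"
  shows "tensor_lift K P f T = (\<Oplus>\<^bsub>P\<^esub>b\<in>{b. p b \<noteq> \<zero>\<^bsub>K\<^esub>}. p b \<odot>\<^bsub>P\<^esub> f (fst b) (snd b))"
  using tensor_lift_eq_free_extension[OF assms] by (simp add: free_extension_def)

lemma bilinear_map_cong:
  assumes "module K M" "module K N" "bilinear_map K M N P f"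
    and "\<And>x y. \<lbrakk>x \<in> carrier M; y \<in> carrier N\<rbrakk> \<Longrightarrow> g x y = f x y"
  shows "bilinear_map K M N P g"
proof -
  interpret M: module K M by fact
  interpret N: module K N by fact
  show ?thesis
    using linear_mapD[OF bilinear_mapD(1)[OF assms(3)]] linear_mapD[OF bilinear_mapD(2)[OF assms(3)]]
    by (intro bilinear_mapI linear_mapI) (auto simp: assms(4))
qed

text \<open>Representatives are supported in \<open>carrier M \<times> carrier N\<close>, which makes a congruence rule
  restricted to the carriers possible.\<close>

lemma tensor_lift_cong:
  assumes "module K M" "module K N" "module K P" "T \<in> carrier (tensor_product K M N)"
    and "bilinear_map K M N P f"
    and "\<And>x y. \<lbrakk>x \<in> carrier M; y \<in> carrier N\<rbrakk> \<Longrightarrow> g x y = f x y"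
  shows "tensor_lift K P g T = tensor_lift K P f T"
proof -
  interpret P: module K P by fact
  obtain p where p: "p \<in> carrier (free_module K (carrier M \<times> carrier N))"
    "T = tensor_kernel K M N +>\<^bsub>free_module K (carrier M \<times> carrier N)\<^esub> p"
    using tensor_product_representative[OF assms(4)] .
  have g: "bilinear_map K M N P g"
    using assms(1,2,5,6) by (rule bilinear_map_cong)
  show ?thesis
    unfolding tensor_lift_eq_finsum[OF assms(1-3,5) p] tensor_lift_eq_finsum[OF assms(1-3) g p]
    using p(1) bilinear_mapD(3)[OF assms(5)]
    by (intro P.finsum_cong') (auto simp: assms(6) free_module_carrier subset_iff)
qed

lemma linear_map_tensor_lift:
  assumes "module K M" "module K N" "module K P" "module K Q" "T \<in> carrier (tensor_product K M N)"
    and "bilinear_map K M N P f" and "linear_map K P Q h"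
  shows "h (tensor_lift K P f T) = tensor_lift K Q (\<lambda>x y. h (f x y)) T"
proof -
  interpret P: module K P by fact
  interpret Q: module K Q by fact
  obtain p where p: "p \<in> carrier (free_module K (carrier M \<times> carrier N))"
    "T = tensor_kernel K M N +>\<^bsub>free_module K (carrier M \<times> carrier N)\<^esub> p"
    using tensor_product_representative[OF assms(5)] .
  have hf: "bilinear_map K M N Q (\<lambda>x y. h (f x y))"
    using assms(6,7) unfolding bilinear_map_def linear_map_def by (auto simp: Pi_iff)
  note f = bilinear_mapD(3)[OF assms(6)]
  note h = linear_mapD[OF assms(7)]
  have "h (tensor_lift K P f T)
      = (\<Oplus>\<^bsub>Q\<^esub>b\<in>{b. p b \<noteq> \<zero>\<^bsub>K\<^esub>}. h (p b \<odot>\<^bsub>P\<^esub> f (fst b) (snd b)))"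
    unfolding tensor_lift_eq_finsum[OF assms(1-3,6) p]
    using p(1) f
    by (intro linear_map_finsum[OF assms(3,4,7)]) (auto simp: free_module_carrier subset_iff)
  also have "\<dots> = (\<Oplus>\<^bsub>Q\<^esub>b\<in>{b. p b \<noteq> \<zero>\<^bsub>K\<^esub>}. p b \<odot>\<^bsub>Q\<^esub> h (f (fst b) (snd b)))"
    using p(1) f h
    by (intro Q.finsum_cong') (auto simp: free_module_carrier subset_iff)
  also have "\<dots> = tensor_lift K Q (\<lambda>x y. h (f x y)) T"
    by (rule tensor_lift_eq_finsum[OF assms(1,2,4) hf p, symmetric])
  finally show ?thesis .
qed

lemma linear_map_smult_finsum:
  assumes "module K P" "finite S" "\<And>s. s \<in> S \<Longrightarrow> c s \<in> carrier K"
    and "\<And>s. s \<in> S \<Longrightarrow> linear_map K U P (g s)"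
  shows "linear_map K U P (\<lambda>u. \<Oplus>\<^bsub>P\<^esub>s\<in>S. c s \<odot>\<^bsub>P\<^esub> g s u)"
proof -
  interpret P: module K P by fact
  note g = linear_mapD[OF assms(4)]
  show ?thesis
  proof (rule linear_mapI)
    fix u assume u: "u \<in> carrier U"
    then show "(\<Oplus>\<^bsub>P\<^esub>s\<in>S. c s \<odot>\<^bsub>P\<^esub> g s u) \<in> carrier P"
      using assms g by (intro P.finsum_closed) auto
    fix v assume v: "v \<in> carrier U"
    have "(\<Oplus>\<^bsub>P\<^esub>s\<in>S. c s \<odot>\<^bsub>P\<^esub> g s (u \<oplus>\<^bsub>U\<^esub> v))
        = (\<Oplus>\<^bsub>P\<^esub>s\<in>S. c s \<odot>\<^bsub>P\<^esub> g s u \<oplus>\<^bsub>P\<^esub> c s \<odot>\<^bsub>P\<^esub> g s v)"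
      using assms(3) g u v by (intro P.finsum_cong') (auto simp: P.smult_r_distr)
    also have "\<dots> = (\<Oplus>\<^bsub>P\<^esub>s\<in>S. c s \<odot>\<^bsub>P\<^esub> g s u) \<oplus>\<^bsub>P\<^esub> (\<Oplus>\<^bsub>P\<^esub>s\<in>S. c s \<odot>\<^bsub>P\<^esub> g s v)"
      using assms(3) g u v by (intro P.finsum_addf) auto
    finally show "(\<Oplus>\<^bsub>P\<^esub>s\<in>S. c s \<odot>\<^bsub>P\<^esub> g s (u \<oplus>\<^bsub>U\<^esub> v)) = \<dots>" .
  next
    fix k u assume k: "k \<in> carrier K" and u: "u \<in> carrier U"
    have "k \<odot>\<^bsub>P\<^esub> (\<Oplus>\<^bsub>P\<^esub>s\<in>S. c s \<odot>\<^bsub>P\<^esub> g s u) = (\<Oplus>\<^bsub>P\<^esub>s\<in>S. k \<odot>\<^bsub>P\<^esub> (c s \<odot>\<^bsub>P\<^esub> g s u))"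
      using assms(2,3) g k u by (intro P.finsum_smult_ldistr) auto
    also have "\<dots> = (\<Oplus>\<^bsub>P\<^esub>s\<in>S. c s \<odot>\<^bsub>P\<^esub> g s (k \<odot>\<^bsub>U\<^esub> u))"
      using assms(3) g k u by (intro P.finsum_cong')
        (auto simp: P.smult_assoc1[symmetric] P.R.m_comm)
    finally show "(\<Oplus>\<^bsub>P\<^esub>s\<in>S. c s \<odot>\<^bsub>P\<^esub> g s (k \<odot>\<^bsub>U\<^esub> u))
      = k \<odot>\<^bsub>P\<^esub> (\<Oplus>\<^bsub>P\<^esub>s\<in>S. c s \<odot>\<^bsub>P\<^esub> g s u)" by simp
  qed
qed

lemma linear_map_tensor_lift_parameter:
  assumes "module K M" "module K N" "module K P" "module K U" "T \<in> carrier (tensor_product K M N)"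
    and "\<And>u. u \<in> carrier U \<Longrightarrow> bilinear_map K M N P (f u)"
    and "\<And>x y. \<lbrakk>x \<in> carrier M; y \<in> carrier N\<rbrakk> \<Longrightarrow> linear_map K U P (\<lambda>u. f u x y)"
  shows "linear_map K U P (\<lambda>u. tensor_lift K P (f u) T)"
proof -
  interpret U: module K U by fact
  obtain p where p: "p \<in> carrier (free_module K (carrier M \<times> carrier N))"
    "T = tensor_kernel K M N +>\<^bsub>free_module K (carrier M \<times> carrier N)\<^esub> p"
    using tensor_product_representative[OF assms(5)] .
  have "linear_map K U P (\<lambda>u. \<Oplus>\<^bsub>P\<^esub>b\<in>{b. p b \<noteq> \<zero>\<^bsub>K\<^esub>}. p b \<odot>\<^bsub>P\<^esub> f u (fst b) (snd b))"
    using p(1) by (intro linear_map_smult_finsum[OF assms(3)])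
      (auto intro!: assms(7) simp: free_module_carrier)
  then show ?thesis
    unfolding linear_map_def Pi_iff
    by (simp add: tensor_lift_eq_finsum[OF assms(1-3,6) p])
qed

text \<open>In an iterated Sweedler sum the integrand of the outer sum is itself a \<open>tensor_lift\<close>; this supplies
  its bilinearity, without which the outer \<open>tensor_lift\<close> is not known to be a finite sum.\<close>

lemma bilinear_map_tensor_lift:
  assumes "module K M" "module K N" "module K P" "module K U" "module K V"
    and "T \<in> carrier (tensor_product K M N)"
    and "\<And>u v. \<lbrakk>u \<in> carrier U; v \<in> carrier V\<rbrakk> \<Longrightarrow> bilinear_map K M N P (f u v)"
    and "\<And>x y. \<lbrakk>x \<in> carrier M; y \<in> carrier N\<rbrakk> \<Longrightarrow> bilinear_map K U V P (\<lambda>u v. f u v x y)"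
  shows "bilinear_map K U V P (\<lambda>u v. tensor_lift K P (f u v) T)"
proof (rule bilinear_mapI)
  show "linear_map K V P (\<lambda>v. tensor_lift K P (f u v) T)" if "u \<in> carrier U" for u
    using assms(7) bilinear_mapD(1)[OF assms(8)] that
    by (intro linear_map_tensor_lift_parameter[OF assms(1-3,5,6)]) auto
  show "linear_map K U P (\<lambda>u. tensor_lift K P (f u v) T)" if "v \<in> carrier V" for v
    using assms(7) bilinear_mapD(2)[OF assms(8)] that
    by (intro linear_map_tensor_lift_parameter[OF assms(1-4,6)]) auto
qed

lemma (in abelian_monoid) finsum_swap:
  assumes "finite S" "finite T" "\<And>s t. \<lbrakk>s \<in> S; t \<in> T\<rbrakk> \<Longrightarrow> g s t \<in> carrier G"
  shows "(\<Oplus>s\<in>S. \<Oplus>t\<in>T. g s t) = (\<Oplus>t\<in>T. \<Oplus>s\<in>S. g s t)"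
  using assms(1,3)
proof (induction S)
  case empty
  then show ?case by simp
next
  case (insert s S)
  have "(\<Oplus>t\<in>T. \<Oplus>s\<in>insert s S. g s t) = (\<Oplus>t\<in>T. g s t \<oplus> (\<Oplus>s\<in>S. g s t))"
    using insert by (intro finsum_cong') (auto simp: Pi_iff)
  also have "\<dots> = (\<Oplus>t\<in>T. g s t) \<oplus> (\<Oplus>t\<in>T. \<Oplus>s\<in>S. g s t)"
    using insert by (intro finsum_addf) auto
  finally show ?case
    using insert by (simp add: Pi_iff)
qed

text \<open>Once both tensors are replaced by representatives, this is the interchange of two finite sums and
  of the commuting scalars that weight them.\<close>

lemma tensor_lift_swap:
  assumes "module K M" "module K N" "module K P" "module K U" "module K V"
    and "S \<in> carrier (tensor_product K U V)" and "T \<in> carrier (tensor_product K M N)"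
    and "\<And>u v. \<lbrakk>u \<in> carrier U; v \<in> carrier V\<rbrakk> \<Longrightarrow> bilinear_map K M N P (f u v)"
    and "\<And>x y. \<lbrakk>x \<in> carrier M; y \<in> carrier N\<rbrakk> \<Longrightarrow> bilinear_map K U V P (\<lambda>u v. f u v x y)"
  shows "tensor_lift K P (\<lambda>u v. tensor_lift K P (f u v) T) S
    = tensor_lift K P (\<lambda>x y. tensor_lift K P (\<lambda>u v. f u v x y) S) T"
proof -
  interpret P: module K P by fact
  obtain p where p: "p \<in> carrier (free_module K (carrier U \<times> carrier V))"
    "S = tensor_kernel K U V +>\<^bsub>free_module K (carrier U \<times> carrier V)\<^esub> p"
    using tensor_product_representative[OF assms(6)] .
  let ?S = "{b. p b \<noteq> \<zero>\<^bsub>K\<^esub>}"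
  let ?g = "\<lambda>b x y. f (fst b) (snd b) x y"
  have S: "finite ?S" "\<And>b. b \<in> ?S \<Longrightarrow> fst b \<in> carrier U \<and> snd b \<in> carrier V"
      "\<And>b. p b \<in> carrier K"
    using p(1) by (auto simp: free_module_carrier)
  obtain q where q: "q \<in> carrier (free_module K (carrier M \<times> carrier N))"
    "T = tensor_kernel K M N +>\<^bsub>free_module K (carrier M \<times> carrier N)\<^esub> q"
    using tensor_product_representative[OF assms(7)] .
  let ?T = "{b. q b \<noteq> \<zero>\<^bsub>K\<^esub>}"
  have T: "finite ?T" "\<And>b. b \<in> ?T \<Longrightarrow> fst b \<in> carrier M \<and> snd b \<in> carrier N"
      "\<And>b. q b \<in> carrier K"
    using q(1) by (auto simp: free_module_carrier)
  note fc = bilinear_mapD(3)[OF assms(8)]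
  have inner: "bilinear_map K U V P (\<lambda>u v. tensor_lift K P (f u v) T)"
    using assms by (intro bilinear_map_tensor_lift[OF assms(1-5,7)])
  have "tensor_lift K P (\<lambda>u v. tensor_lift K P (f u v) T) S
     = (\<Oplus>\<^bsub>P\<^esub>b\<in>?S. p b \<odot>\<^bsub>P\<^esub> tensor_lift K P (f (fst b) (snd b)) T)"
    by (rule tensor_lift_eq_finsum[OF assms(4,5,3) inner p])
  also have "\<dots> = (\<Oplus>\<^bsub>P\<^esub>b\<in>?S. p b \<odot>\<^bsub>P\<^esub>
      (\<Oplus>\<^bsub>P\<^esub>d\<in>?T. q d \<odot>\<^bsub>P\<^esub> f (fst b) (snd b) (fst d) (snd d)))"
    using S T fc
    by (intro P.finsum_cong') (auto simp: tensor_lift_eq_finsum[OF assms(1-3,8) q] Pi_iff)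
  also have "\<dots> = (\<Oplus>\<^bsub>P\<^esub>d\<in>?T. q d \<odot>\<^bsub>P\<^esub>
      (\<Oplus>\<^bsub>P\<^esub>b\<in>?S. p b \<odot>\<^bsub>P\<^esub> f (fst b) (snd b) (fst d) (snd d)))"
  proof -
    have "p b \<odot>\<^bsub>P\<^esub> (q d \<odot>\<^bsub>P\<^esub> ?g b (fst d) (snd d)) = q d \<odot>\<^bsub>P\<^esub> (p b \<odot>\<^bsub>P\<^esub> ?g b (fst d) (snd d))"
      if "b \<in> ?S" "d \<in> ?T" for b d
      using S T fc that by (simp add: P.smult_assoc1[symmetric] P.R.m_comm)
    then have "(\<Oplus>\<^bsub>P\<^esub>b\<in>?S. p b \<odot>\<^bsub>P\<^esub> (\<Oplus>\<^bsub>P\<^esub>d\<in>?T. q d \<odot>\<^bsub>P\<^esub> ?g b (fst d) (snd d)))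
      = (\<Oplus>\<^bsub>P\<^esub>b\<in>?S. \<Oplus>\<^bsub>P\<^esub>d\<in>?T. q d \<odot>\<^bsub>P\<^esub> (p b \<odot>\<^bsub>P\<^esub> ?g b (fst d) (snd d)))"
      using S T fc
      by (intro P.finsum_cong')
        (auto simp: P.finsum_smult_ldistr Pi_iff intro!: P.finsum_cong' P.finsum_closed)
    also have "\<dots> = (\<Oplus>\<^bsub>P\<^esub>d\<in>?T. \<Oplus>\<^bsub>P\<^esub>b\<in>?S. q d \<odot>\<^bsub>P\<^esub> (p b \<odot>\<^bsub>P\<^esub> ?g b (fst d) (snd d)))"
      using S T fc by (intro P.finsum_swap) auto
    also have "\<dots> = (\<Oplus>\<^bsub>P\<^esub>d\<in>?T. q d \<odot>\<^bsub>P\<^esub> (\<Oplus>\<^bsub>P\<^esub>b\<in>?S. p b \<odot>\<^bsub>P\<^esub> ?g b (fst d) (snd d)))"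
      using S T fc
      by (intro P.finsum_cong')
        (auto simp: P.finsum_smult_ldistr Pi_iff intro!: P.finsum_closed)
    finally show ?thesis .
  qed
  also have "\<dots> = (\<Oplus>\<^bsub>P\<^esub>d\<in>?T. q d \<odot>\<^bsub>P\<^esub>
      tensor_lift K P (\<lambda>u v. f u v (fst d) (snd d)) S)"
    using S T fc
    by (intro P.finsum_cong') (auto simp: tensor_lift_eq_finsum[OF assms(4,5,3,9) p] Pi_iff)
  also have "\<dots> = tensor_lift K P (\<lambda>x y. tensor_lift K P (\<lambda>u v. f u v x y) S) T"
    by (rule tensor_lift_eq_finsum[OF assms(1-3) _ q, symmetric])
       (use assms in \<open>intro bilinear_map_tensor_lift[OF assms(4,5,3,1,2,6)]\<close>)
  finally show ?thesis .
qed

lemma tensor_lift_cong2: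
  assumes "module K M" "module K N" "module K P" "module K U" "module K V"
    and "S \<in> carrier (tensor_product K U V)" and "T \<in> carrier (tensor_product K M N)"
    and "\<And>u v. \<lbrakk>u \<in> carrier U; v \<in> carrier V\<rbrakk> \<Longrightarrow> bilinear_map K M N P (f u v)"
    and "\<And>x y. \<lbrakk>x \<in> carrier M; y \<in> carrier N\<rbrakk> \<Longrightarrow> bilinear_map K U V P (\<lambda>u v. f u v x y)"
    and "\<And>u v x y. \<lbrakk>u \<in> carrier U; v \<in> carrier V; x \<in> carrier M; y \<in> carrier N\<rbrakk>
      \<Longrightarrow> g u v x y = f u v x y"
  shows "tensor_lift K P (\<lambda>u v. tensor_lift K P (g u v) T) S
    = tensor_lift K P (\<lambda>u v. tensor_lift K P (f u v) T) S"
proof (rule tensor_lift_cong[OF assms(4,5,3,6)])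
  show "bilinear_map K U V P (\<lambda>u v. tensor_lift K P (f u v) T)"
    using assms(8,9) by (intro bilinear_map_tensor_lift[OF assms(1-5,7)])
  show "tensor_lift K P (g u v) T = tensor_lift K P (f u v) T"
    if "u \<in> carrier U" "v \<in> carrier V" for u v
    using assms(8,10) that by (intro tensor_lift_cong[OF assms(1-3,7)])
qed

lemma linear_map_tensor_lift2:
  assumes "module K M" "module K N" "module K P" "module K Q" "module K U" "module K V"
    and "S \<in> carrier (tensor_product K U V)" and "T \<in> carrier (tensor_product K M N)"
    and "\<And>u v. \<lbrakk>u \<in> carrier U; v \<in> carrier V\<rbrakk> \<Longrightarrow> bilinear_map K M N P (f u v)"
    and "\<And>x y. \<lbrakk>x \<in> carrier M; y \<in> carrier N\<rbrakk> \<Longrightarrow> bilinear_map K U V P (\<lambda>u v. f u v x y)"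
    and "linear_map K P Q h"
  shows "h (tensor_lift K P (\<lambda>u v. tensor_lift K P (f u v) T) S)
    = tensor_lift K Q (\<lambda>u v. tensor_lift K Q (\<lambda>x y. h (f u v x y)) T) S"
proof -
  have inner: "bilinear_map K U V P (\<lambda>u v. tensor_lift K P (f u v) T)"
    using assms(9,10) by (intro bilinear_map_tensor_lift[OF assms(1-3,5,6,8)])
  have outer: "bilinear_map K U V Q (\<lambda>u v. h (tensor_lift K P (f u v) T))"
    using inner assms(11) unfolding bilinear_map_def linear_map_def by (auto simp: Pi_iff)
  have "h (tensor_lift K P (\<lambda>u v. tensor_lift K P (f u v) T) S)
      = tensor_lift K Q (\<lambda>u v. h (tensor_lift K P (f u v) T)) S"
    by (rule linear_map_tensor_lift[OF assms(5,6,3,4,7) inner assms(11)])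
  also have "\<dots> = tensor_lift K Q (\<lambda>u v. tensor_lift K Q (\<lambda>x y. h (f u v x y)) T) S"
    using linear_map_tensor_lift[OF assms(1-4,8,9,11)]
    by (intro tensor_lift_cong[OF assms(5,6,4,7) outer, symmetric]) simp
  finally show ?thesis .
qed

section \<open>The Yang--Baxter equations\<close>

context cobraided_hom_bialgebra
begin

lemma modules: "module K A" "module K (ring_as_module K)"
  by (rule module_axioms) (rule module_ring_as_module[OF R.is_cring])

lemma Delta_closed: "x \<in> carrier A \<Longrightarrow> \<Delta> x \<in> carrier (tensor_product K A A)"
  using linear_mapD(1)[OF Delta_linear] .

text \<open>Rewriting with these rules and then normalising in \<open>K\<close> and \<open>A\<close> proves that an expression built from
  \<open>R\<close>, \<open>\<mu>\<close> and \<open>\<alpha>\<close> is linear in a variable that occurs once in it.\<close>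

lemmas multilinear_rules =
  linear_mapD[OF hom_associative_algebra.alpha_linear[OF hom_associative_algebra_axioms]]
  linear_mapD[OF bilinear_mapD(1)[OF R_bilinear], simplified]
  linear_mapD[OF bilinear_mapD(2)[OF R_bilinear], simplified]
  linear_mapD[OF bilinear_mapD(1)[OF mu_bilinear]]
  linear_mapD[OF bilinear_mapD(2)[OF mu_bilinear]]

lemma sweedler_rotate:
  assumes "x \<in> carrier A" "y \<in> carrier A" "z \<in> carrier A"
    and X: "\<And>y\<^sub>1 y\<^sub>2 z\<^sub>1 z\<^sub>2. \<lbrakk>y\<^sub>1 \<in> carrier A; y\<^sub>2 \<in> carrier A; z\<^sub>1 \<in> carrier A; z\<^sub>2 \<in> carrier A\<rbrakk>
      \<Longrightarrow> bilinear_map K A A (ring_as_module K) (\<lambda>x\<^sub>1 x\<^sub>2. f x\<^sub>1 x\<^sub>2 y\<^sub>1 y\<^sub>2 z\<^sub>1 z\<^sub>2)"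
    and Y: "\<And>x\<^sub>1 x\<^sub>2 z\<^sub>1 z\<^sub>2. \<lbrakk>x\<^sub>1 \<in> carrier A; x\<^sub>2 \<in> carrier A; z\<^sub>1 \<in> carrier A; z\<^sub>2 \<in> carrier A\<rbrakk>
      \<Longrightarrow> bilinear_map K A A (ring_as_module K) (\<lambda>y\<^sub>1 y\<^sub>2. f x\<^sub>1 x\<^sub>2 y\<^sub>1 y\<^sub>2 z\<^sub>1 z\<^sub>2)"
    and Z: "\<And>x\<^sub>1 x\<^sub>2 y\<^sub>1 y\<^sub>2. \<lbrakk>x\<^sub>1 \<in> carrier A; x\<^sub>2 \<in> carrier A; y\<^sub>1 \<in> carrier A; y\<^sub>2 \<in> carrier A\<rbrakk>
      \<Longrightarrow> bilinear_map K A A (ring_as_module K) (\<lambda>z\<^sub>1 z\<^sub>2. f x\<^sub>1 x\<^sub>2 y\<^sub>1 y\<^sub>2 z\<^sub>1 z\<^sub>2)"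
  shows "scalar_sweedler K (\<lambda>x\<^sub>1 x\<^sub>2. scalar_sweedler K (\<lambda>y\<^sub>1 y\<^sub>2. scalar_sweedler K (\<lambda>z\<^sub>1 z\<^sub>2.
           f x\<^sub>1 x\<^sub>2 y\<^sub>1 y\<^sub>2 z\<^sub>1 z\<^sub>2) (\<Delta> z)) (\<Delta> y)) (\<Delta> x)
       = scalar_sweedler K (\<lambda>y\<^sub>1 y\<^sub>2. scalar_sweedler K (\<lambda>z\<^sub>1 z\<^sub>2. scalar_sweedler K (\<lambda>x\<^sub>1 x\<^sub>2.
           f x\<^sub>1 x\<^sub>2 y\<^sub>1 y\<^sub>2 z\<^sub>1 z\<^sub>2) (\<Delta> x)) (\<Delta> z)) (\<Delta> y)"
proof -
  note A = modules(1) and K = modules(2)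
  note \<Delta> = Delta_closed[OF assms(1)] Delta_closed[OF assms(2)] Delta_closed[OF assms(3)]
  note lift = bilinear_map_tensor_lift[OF A A K A A] and swap = tensor_lift_swap[OF A A K A A]
  have "scalar_sweedler K (\<lambda>x\<^sub>1 x\<^sub>2. scalar_sweedler K (\<lambda>y\<^sub>1 y\<^sub>2. scalar_sweedler K (\<lambda>z\<^sub>1 z\<^sub>2.
           f x\<^sub>1 x\<^sub>2 y\<^sub>1 y\<^sub>2 z\<^sub>1 z\<^sub>2) (\<Delta> z)) (\<Delta> y)) (\<Delta> x)
       = scalar_sweedler K (\<lambda>y\<^sub>1 y\<^sub>2. scalar_sweedler K (\<lambda>x\<^sub>1 x\<^sub>2. scalar_sweedler K (\<lambda>z\<^sub>1 z\<^sub>2.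
           f x\<^sub>1 x\<^sub>2 y\<^sub>1 y\<^sub>2 z\<^sub>1 z\<^sub>2) (\<Delta> z)) (\<Delta> x)) (\<Delta> y)"
    using X Y Z by (intro swap \<Delta> lift)
  also have "\<dots> = scalar_sweedler K (\<lambda>y\<^sub>1 y\<^sub>2. scalar_sweedler K (\<lambda>z\<^sub>1 z\<^sub>2. scalar_sweedler K (\<lambda>x\<^sub>1 x\<^sub>2.
           f x\<^sub>1 x\<^sub>2 y\<^sub>1 y\<^sub>2 z\<^sub>1 z\<^sub>2) (\<Delta> x)) (\<Delta> z)) (\<Delta> y)"
    using X Y Z by (intro tensor_lift_cong[OF A A K \<Delta>(2)] lift swap \<Delta>)
  finally show ?thesis .
qed

lemma scalar_sweedler_cmult:
  assumes "c \<in> carrier K" "x \<in> carrier A" "bilinear_map K A A (ring_as_module K) f"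
  shows "scalar_sweedler K (\<lambda>x\<^sub>1 x\<^sub>2. c \<otimes>\<^bsub>K\<^esub> f x\<^sub>1 x\<^sub>2) (\<Delta> x) = c \<otimes>\<^bsub>K\<^esub> scalar_sweedler K f (\<Delta> x)"
proof -
  have "linear_map K (ring_as_module K) (ring_as_module K) (\<lambda>t. c \<otimes>\<^bsub>K\<^esub> t)"
    using assms(1) by (intro linear_mapI) (simp_all add: R.r_distr R.m_ac)
  then show ?thesis
    by (rule linear_map_tensor_lift[OF modules(1,1,2,2) Delta_closed[OF assms(2)] assms(3), symmetric])
qed

text \<open>The factor \<open>c\<close> is a value of \<open>R\<close> on components of the other arguments. It stands at different
  places in the four sums to which this lemma and the next apply, hence the integrand \<open>f\<close> that is
  only pointwise equal to the product.\<close>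

lemma scaled_R_mu_right:
  assumes x: "x \<in> carrier A" and c: "c \<in> carrier K" and y: "y \<in> carrier A" and z: "z \<in> carrier A"
    and f: "\<And>x\<^sub>1 x\<^sub>2. \<lbrakk>x\<^sub>1 \<in> carrier A; x\<^sub>2 \<in> carrier A\<rbrakk>
      \<Longrightarrow> f x\<^sub>1 x\<^sub>2 = c \<otimes>\<^bsub>K\<^esub> (R x\<^sub>1 (\<alpha> z) \<otimes>\<^bsub>K\<^esub> R x\<^sub>2 (\<alpha> y))"
  shows "scalar_sweedler K f (\<Delta> x) = R (\<alpha> x) (c \<odot>\<^bsub>A\<^esub> \<mu> y z)"
proof -
  let ?g = "\<lambda>x\<^sub>1 x\<^sub>2. R x\<^sub>1 (\<alpha> z) \<otimes>\<^bsub>K\<^esub> R x\<^sub>2 (\<alpha> y)"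
  have "bilinear_map K A A (ring_as_module K) (\<lambda>x\<^sub>1 x\<^sub>2. c \<otimes>\<^bsub>K\<^esub> ?g x\<^sub>1 x\<^sub>2)"
    using c y z by (intro bilinear_mapI linear_mapI)
      (simp_all add: multilinear_rules R.l_distr R.r_distr R.m_ac)
  then have "scalar_sweedler K f (\<Delta> x) = scalar_sweedler K (\<lambda>x\<^sub>1 x\<^sub>2. c \<otimes>\<^bsub>K\<^esub> ?g x\<^sub>1 x\<^sub>2) (\<Delta> x)"
    by (rule tensor_lift_cong[OF modules(1,1,2) Delta_closed[OF x] _ f])
  moreover have "bilinear_map K A A (ring_as_module K) ?g"
    using y z by (intro bilinear_mapI linear_mapI)
      (simp_all add: multilinear_rules R.l_distr R.r_distr R.m_ac)
  ultimately show ?thesis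
    using x y z c by (simp add: scalar_sweedler_cmult R_mu_right multilinear_rules)
qed

lemma scaled_R_mu_left:
  assumes z: "z \<in> carrier A" and c: "c \<in> carrier K" and x: "x \<in> carrier A" and y: "y \<in> carrier A"
    and f: "\<And>z\<^sub>1 z\<^sub>2. \<lbrakk>z\<^sub>1 \<in> carrier A; z\<^sub>2 \<in> carrier A\<rbrakk>
      \<Longrightarrow> f z\<^sub>1 z\<^sub>2 = c \<otimes>\<^bsub>K\<^esub> (R (\<alpha> x) z\<^sub>1 \<otimes>\<^bsub>K\<^esub> R (\<alpha> y) z\<^sub>2)"
  shows "scalar_sweedler K f (\<Delta> z) = R (c \<odot>\<^bsub>A\<^esub> \<mu> x y) (\<alpha> z)"
proof -
  let ?g = "\<lambda>z\<^sub>1 z\<^sub>2. R (\<alpha> x) z\<^sub>1 \<otimes>\<^bsub>K\<^esub> R (\<alpha> y) z\<^sub>2"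
  have "bilinear_map K A A (ring_as_module K) (\<lambda>z\<^sub>1 z\<^sub>2. c \<otimes>\<^bsub>K\<^esub> ?g z\<^sub>1 z\<^sub>2)"
    using c x y by (intro bilinear_mapI linear_mapI)
      (simp_all add: multilinear_rules R.l_distr R.r_distr R.m_ac)
  then have "scalar_sweedler K f (\<Delta> z) = scalar_sweedler K (\<lambda>z\<^sub>1 z\<^sub>2. c \<otimes>\<^bsub>K\<^esub> ?g z\<^sub>1 z\<^sub>2) (\<Delta> z)"
    by (rule tensor_lift_cong[OF modules(1,1,2) Delta_closed[OF z] _ f])
  moreover have "bilinear_map K A A (ring_as_module K) ?g"
    using x y by (intro bilinear_mapI linear_mapI)
      (simp_all add: multilinear_rules R.l_distr R.r_distr R.m_ac)
  ultimately show ?thesis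
    using x y z c by (simp add: scalar_sweedler_cmult R_mu_left multilinear_rules)
qed

text \<open>Up to the scalar \<open>R y\<^sub>2 z\<^sub>2\<close> (or \<open>R y\<^sub>1 z\<^sub>1\<close>), the sum over \<open>\<Delta> x\<close> on either side is the value of
  \<open>R (\<alpha> x)\<close> at a product of components of \<open>y\<close> and \<open>z\<close>. The sum over \<open>\<Delta> x\<close> has to become the
  innermost one before multiplicativity in the second argument applies; the two sides are then the
  image under \<open>R (\<alpha> x)\<close> of the two sides of the commutation rule for \<open>y\<close> and \<open>z\<close>.\<close>

lemma yang_baxter_from_R_mu_right:
  assumes x: "x \<in> carrier A" and y: "y \<in> carrier A" and z: "z \<in> carrier A"
  shows "scalar_sweedler K (\<lambda>x\<^sub>1 x\<^sub>2. scalar_sweedler K (\<lambda>y\<^sub>1 y\<^sub>2. scalar_sweedler K (\<lambda>z\<^sub>1 z\<^sub>2.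
             R x\<^sub>1 (\<alpha> y\<^sub>1) \<otimes>\<^bsub>K\<^esub> R x\<^sub>2 (\<alpha> z\<^sub>1) \<otimes>\<^bsub>K\<^esub> R y\<^sub>2 z\<^sub>2) (\<Delta> z)) (\<Delta> y)) (\<Delta> x)
         = scalar_sweedler K (\<lambda>x\<^sub>1 x\<^sub>2. scalar_sweedler K (\<lambda>y\<^sub>1 y\<^sub>2. scalar_sweedler K (\<lambda>z\<^sub>1 z\<^sub>2.
             R y\<^sub>1 z\<^sub>1 \<otimes>\<^bsub>K\<^esub> R x\<^sub>1 (\<alpha> z\<^sub>2) \<otimes>\<^bsub>K\<^esub> R x\<^sub>2 (\<alpha> y\<^sub>2)) (\<Delta> z)) (\<Delta> y)) (\<Delta> x)"
proof -
  note A = modules(1) and K = modules(2)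
  note \<Delta> = Delta_closed[OF y] Delta_closed[OF z]
  let ?K = "ring_as_module K"
  let ?h = "R (\<alpha> x)"
  have \<alpha>x: "\<alpha> x \<in> carrier A"
    using x by (simp add: multilinear_rules)
  have h: "linear_map K A ?K ?h"
    using bilinear_mapD(1)[OF R_bilinear \<alpha>x] .
  have left: "scalar_sweedler K (\<lambda>x\<^sub>1 x\<^sub>2. R x\<^sub>1 (\<alpha> y\<^sub>1) \<otimes>\<^bsub>K\<^esub> R x\<^sub>2 (\<alpha> z\<^sub>1) \<otimes>\<^bsub>K\<^esub> R y\<^sub>2 z\<^sub>2) (\<Delta> x)
      = ?h (R y\<^sub>2 z\<^sub>2 \<odot>\<^bsub>A\<^esub> \<mu> z\<^sub>1 y\<^sub>1)"
    if c: "y\<^sub>1 \<in> carrier A" "y\<^sub>2 \<in> carrier A" "z\<^sub>1 \<in> carrier A" "z\<^sub>2 \<in> carrier A" for y\<^sub>1 y\<^sub>2 z\<^sub>1 z\<^sub>2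
    using c x by (intro scaled_R_mu_right) (simp_all add: multilinear_rules R.m_ac)
  have right: "scalar_sweedler K (\<lambda>x\<^sub>1 x\<^sub>2. R y\<^sub>1 z\<^sub>1 \<otimes>\<^bsub>K\<^esub> R x\<^sub>1 (\<alpha> z\<^sub>2) \<otimes>\<^bsub>K\<^esub> R x\<^sub>2 (\<alpha> y\<^sub>2)) (\<Delta> x)
      = ?h (R y\<^sub>1 z\<^sub>1 \<odot>\<^bsub>A\<^esub> \<mu> y\<^sub>2 z\<^sub>2)"
    if c: "y\<^sub>1 \<in> carrier A" "y\<^sub>2 \<in> carrier A" "z\<^sub>1 \<in> carrier A" "z\<^sub>2 \<in> carrier A" for y\<^sub>1 y\<^sub>2 z\<^sub>1 z\<^sub>2
    using c x by (intro scaled_R_mu_right) (simp_all add: multilinear_rules R.m_ac)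
  note pull = linear_map_tensor_lift2[OF A A A K A A \<Delta> _ _ h]
  have "scalar_sweedler K (\<lambda>x\<^sub>1 x\<^sub>2. scalar_sweedler K (\<lambda>y\<^sub>1 y\<^sub>2. scalar_sweedler K (\<lambda>z\<^sub>1 z\<^sub>2.
             R x\<^sub>1 (\<alpha> y\<^sub>1) \<otimes>\<^bsub>K\<^esub> R x\<^sub>2 (\<alpha> z\<^sub>1) \<otimes>\<^bsub>K\<^esub> R y\<^sub>2 z\<^sub>2) (\<Delta> z)) (\<Delta> y)) (\<Delta> x)
       = scalar_sweedler K (\<lambda>y\<^sub>1 y\<^sub>2. scalar_sweedler K (\<lambda>z\<^sub>1 z\<^sub>2. scalar_sweedler K (\<lambda>x\<^sub>1 x\<^sub>2.
             R x\<^sub>1 (\<alpha> y\<^sub>1) \<otimes>\<^bsub>K\<^esub> R x\<^sub>2 (\<alpha> z\<^sub>1) \<otimes>\<^bsub>K\<^esub> R y\<^sub>2 z\<^sub>2) (\<Delta> x)) (\<Delta> z)) (\<Delta> y)"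
    by (intro sweedler_rotate x y z bilinear_mapI linear_mapI)
      (simp_all add: multilinear_rules R.l_distr R.r_distr R.m_ac)
  also have "\<dots> = scalar_sweedler K (\<lambda>y\<^sub>1 y\<^sub>2. scalar_sweedler K (\<lambda>z\<^sub>1 z\<^sub>2.
             ?h (R y\<^sub>2 z\<^sub>2 \<odot>\<^bsub>A\<^esub> \<mu> z\<^sub>1 y\<^sub>1)) (\<Delta> z)) (\<Delta> y)"
    by (intro tensor_lift_cong2[OF A A K A A \<Delta>] left bilinear_mapI linear_mapI)
      (simp_all add: multilinear_rules \<alpha>x smult_l_distr smult_r_distr
        R.l_distr R.r_distr R.m_ac)
  also have "\<dots> = ?h (tensor_lift K A (\<lambda>y\<^sub>1 y\<^sub>2. tensor_lift K A (\<lambda>z\<^sub>1 z\<^sub>2.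
             R y\<^sub>2 z\<^sub>2 \<odot>\<^bsub>A\<^esub> \<mu> z\<^sub>1 y\<^sub>1) (\<Delta> z)) (\<Delta> y))"
    by (intro pull[symmetric] bilinear_mapI linear_mapI)
      (simp_all add: multilinear_rules smult_l_distr smult_r_distr
        smult_assoc1[symmetric] R.m_ac)
  also have "\<dots> = ?h (tensor_lift K A (\<lambda>y\<^sub>1 y\<^sub>2. tensor_lift K A (\<lambda>z\<^sub>1 z\<^sub>2.
             R y\<^sub>1 z\<^sub>1 \<odot>\<^bsub>A\<^esub> \<mu> y\<^sub>2 z\<^sub>2) (\<Delta> z)) (\<Delta> y))"
    using R_commute[OF y z] by simp
  also have "\<dots> = scalar_sweedler K (\<lambda>y\<^sub>1 y\<^sub>2. scalar_sweedler K (\<lambda>z\<^sub>1 z\<^sub>2.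
             ?h (R y\<^sub>1 z\<^sub>1 \<odot>\<^bsub>A\<^esub> \<mu> y\<^sub>2 z\<^sub>2)) (\<Delta> z)) (\<Delta> y)"
    by (intro pull bilinear_mapI linear_mapI)
      (simp_all add: multilinear_rules smult_l_distr smult_r_distr
        smult_assoc1[symmetric] R.m_ac)
  also have "\<dots> = scalar_sweedler K (\<lambda>y\<^sub>1 y\<^sub>2. scalar_sweedler K (\<lambda>z\<^sub>1 z\<^sub>2. scalar_sweedler K (\<lambda>x\<^sub>1 x\<^sub>2.
             R y\<^sub>1 z\<^sub>1 \<otimes>\<^bsub>K\<^esub> R x\<^sub>1 (\<alpha> z\<^sub>2) \<otimes>\<^bsub>K\<^esub> R x\<^sub>2 (\<alpha> y\<^sub>2)) (\<Delta> x)) (\<Delta> z)) (\<Delta> y)"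
    by (intro tensor_lift_cong2[OF A A K A A \<Delta>, symmetric] right bilinear_mapI linear_mapI)
      (simp_all add: multilinear_rules \<alpha>x smult_l_distr smult_r_distr
        R.l_distr R.r_distr R.m_ac)
  also have "\<dots> = scalar_sweedler K (\<lambda>x\<^sub>1 x\<^sub>2. scalar_sweedler K (\<lambda>y\<^sub>1 y\<^sub>2. scalar_sweedler K (\<lambda>z\<^sub>1 z\<^sub>2.
             R y\<^sub>1 z\<^sub>1 \<otimes>\<^bsub>K\<^esub> R x\<^sub>1 (\<alpha> z\<^sub>2) \<otimes>\<^bsub>K\<^esub> R x\<^sub>2 (\<alpha> y\<^sub>2)) (\<Delta> z)) (\<Delta> y)) (\<Delta> x)"
    by (intro sweedler_rotate[symmetric] x y z bilinear_mapI linear_mapI)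
      (simp_all add: multilinear_rules R.l_distr R.r_distr R.m_ac)
  finally show ?thesis .
qed

text \<open>Here \<open>\<Delta> z\<close> is already the innermost sum, and the two sides are the image of the commutation rule
  for \<open>x\<close> and \<open>y\<close> under \<open>R\<close> with second argument \<open>\<alpha> z\<close>.\<close>

lemma yang_baxter_from_R_mu_left:
  assumes x: "x \<in> carrier A" and y: "y \<in> carrier A" and z: "z \<in> carrier A"
  shows "scalar_sweedler K (\<lambda>x\<^sub>1 x\<^sub>2. scalar_sweedler K (\<lambda>y\<^sub>1 y\<^sub>2. scalar_sweedler K (\<lambda>z\<^sub>1 z\<^sub>2.
             R x\<^sub>1 y\<^sub>1 \<otimes>\<^bsub>K\<^esub> R (\<alpha> x\<^sub>2) z\<^sub>1 \<otimes>\<^bsub>K\<^esub> R (\<alpha> y\<^sub>2) z\<^sub>2) (\<Delta> z)) (\<Delta> y)) (\<Delta> x)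
         = scalar_sweedler K (\<lambda>x\<^sub>1 x\<^sub>2. scalar_sweedler K (\<lambda>y\<^sub>1 y\<^sub>2. scalar_sweedler K (\<lambda>z\<^sub>1 z\<^sub>2.
             R (\<alpha> y\<^sub>1) z\<^sub>1 \<otimes>\<^bsub>K\<^esub> R (\<alpha> x\<^sub>1) z\<^sub>2 \<otimes>\<^bsub>K\<^esub> R x\<^sub>2 y\<^sub>2) (\<Delta> z)) (\<Delta> y)) (\<Delta> x)"
proof -
  note A = modules(1) and K = modules(2)
  note \<Delta> = Delta_closed[OF x] Delta_closed[OF y]
  let ?K = "ring_as_module K"
  let ?h = "\<lambda>a. R a (\<alpha> z)"
  have \<alpha>z: "\<alpha> z \<in> carrier A"
    using z by (simp add: multilinear_rules)
  have h: "linear_map K A ?K ?h"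
    using bilinear_mapD(2)[OF R_bilinear \<alpha>z] .
  have left: "scalar_sweedler K (\<lambda>z\<^sub>1 z\<^sub>2. R x\<^sub>1 y\<^sub>1 \<otimes>\<^bsub>K\<^esub> R (\<alpha> x\<^sub>2) z\<^sub>1 \<otimes>\<^bsub>K\<^esub> R (\<alpha> y\<^sub>2) z\<^sub>2) (\<Delta> z)
      = ?h (R x\<^sub>1 y\<^sub>1 \<odot>\<^bsub>A\<^esub> \<mu> x\<^sub>2 y\<^sub>2)"
    if c: "x\<^sub>1 \<in> carrier A" "x\<^sub>2 \<in> carrier A" "y\<^sub>1 \<in> carrier A" "y\<^sub>2 \<in> carrier A" for x\<^sub>1 x\<^sub>2 y\<^sub>1 y\<^sub>2
    using c z by (intro scaled_R_mu_left) (simp_all add: multilinear_rules R.m_ac)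
  have right: "scalar_sweedler K (\<lambda>z\<^sub>1 z\<^sub>2. R (\<alpha> y\<^sub>1) z\<^sub>1 \<otimes>\<^bsub>K\<^esub> R (\<alpha> x\<^sub>1) z\<^sub>2 \<otimes>\<^bsub>K\<^esub> R x\<^sub>2 y\<^sub>2) (\<Delta> z)
      = ?h (R x\<^sub>2 y\<^sub>2 \<odot>\<^bsub>A\<^esub> \<mu> y\<^sub>1 x\<^sub>1)"
    if c: "x\<^sub>1 \<in> carrier A" "x\<^sub>2 \<in> carrier A" "y\<^sub>1 \<in> carrier A" "y\<^sub>2 \<in> carrier A" for x\<^sub>1 x\<^sub>2 y\<^sub>1 y\<^sub>2
    using c z by (intro scaled_R_mu_left) (simp_all add: multilinear_rules R.m_ac)
  note pull = linear_map_tensor_lift2[OF A A A K A A \<Delta> _ _ h]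
  have "scalar_sweedler K (\<lambda>x\<^sub>1 x\<^sub>2. scalar_sweedler K (\<lambda>y\<^sub>1 y\<^sub>2. scalar_sweedler K (\<lambda>z\<^sub>1 z\<^sub>2.
             R x\<^sub>1 y\<^sub>1 \<otimes>\<^bsub>K\<^esub> R (\<alpha> x\<^sub>2) z\<^sub>1 \<otimes>\<^bsub>K\<^esub> R (\<alpha> y\<^sub>2) z\<^sub>2) (\<Delta> z)) (\<Delta> y)) (\<Delta> x)
       = scalar_sweedler K (\<lambda>x\<^sub>1 x\<^sub>2. scalar_sweedler K (\<lambda>y\<^sub>1 y\<^sub>2.
             ?h (R x\<^sub>1 y\<^sub>1 \<odot>\<^bsub>A\<^esub> \<mu> x\<^sub>2 y\<^sub>2)) (\<Delta> y)) (\<Delta> x)"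
    by (intro tensor_lift_cong2[OF A A K A A \<Delta>] left bilinear_mapI linear_mapI)
      (simp_all add: multilinear_rules \<alpha>z smult_l_distr smult_r_distr
        R.l_distr R.r_distr R.m_ac)
  also have "\<dots> = ?h (tensor_lift K A (\<lambda>x\<^sub>1 x\<^sub>2. tensor_lift K A (\<lambda>y\<^sub>1 y\<^sub>2.
             R x\<^sub>1 y\<^sub>1 \<odot>\<^bsub>A\<^esub> \<mu> x\<^sub>2 y\<^sub>2) (\<Delta> y)) (\<Delta> x))"
    by (intro pull[symmetric] bilinear_mapI linear_mapI)
      (simp_all add: multilinear_rules smult_l_distr smult_r_distr
        smult_assoc1[symmetric] R.m_ac)
  also have "\<dots> = ?h (tensor_lift K A (\<lambda>x\<^sub>1 x\<^sub>2. tensor_lift K A (\<lambda>y\<^sub>1 y\<^sub>2.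
             R x\<^sub>2 y\<^sub>2 \<odot>\<^bsub>A\<^esub> \<mu> y\<^sub>1 x\<^sub>1) (\<Delta> y)) (\<Delta> x))"
    using R_commute[OF x y] by simp
  also have "\<dots> = scalar_sweedler K (\<lambda>x\<^sub>1 x\<^sub>2. scalar_sweedler K (\<lambda>y\<^sub>1 y\<^sub>2.
             ?h (R x\<^sub>2 y\<^sub>2 \<odot>\<^bsub>A\<^esub> \<mu> y\<^sub>1 x\<^sub>1)) (\<Delta> y)) (\<Delta> x)"
    by (intro pull bilinear_mapI linear_mapI)
      (simp_all add: multilinear_rules smult_l_distr smult_r_distr
        smult_assoc1[symmetric] R.m_ac)
  also have "\<dots> = scalar_sweedler K (\<lambda>x\<^sub>1 x\<^sub>2. scalar_sweedler K (\<lambda>y\<^sub>1 y\<^sub>2. scalar_sweedler K (\<lambda>z\<^sub>1 z\<^sub>2.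
             R (\<alpha> y\<^sub>1) z\<^sub>1 \<otimes>\<^bsub>K\<^esub> R (\<alpha> x\<^sub>1) z\<^sub>2 \<otimes>\<^bsub>K\<^esub> R x\<^sub>2 y\<^sub>2) (\<Delta> z)) (\<Delta> y)) (\<Delta> x)"
    by (intro tensor_lift_cong2[OF A A K A A \<Delta>, symmetric] right bilinear_mapI linear_mapI)
      (simp_all add: multilinear_rules \<alpha>z smult_l_distr smult_r_distr
        R.l_distr R.r_distr R.m_ac)
  finally show ?thesis .
qed

end

theorem theorem2p7:
  fixes K :: "('k, 'r) ring_scheme" and A :: "('k, 'a, 'm) module_scheme"
    and \<mu> :: "'a \<Rightarrow> 'a \<Rightarrow> 'a" and \<Delta> :: "'a \<Rightarrow> ('a \<times> 'a \<Rightarrow> 'k) set"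
    and \<alpha> :: "'a \<Rightarrow> 'a" and R :: "'a \<Rightarrow> 'a \<Rightarrow> 'k"
  assumes "char_zero_ring K"
    and "cobraided_hom_bialgebra K A \<mu> \<Delta> \<alpha> R"
    and "x \<in> carrier A" and "y \<in> carrier A" and "z \<in> carrier A"
  shows "scalar_sweedler K (\<lambda>x\<^sub>1 x\<^sub>2. scalar_sweedler K (\<lambda>y\<^sub>1 y\<^sub>2. scalar_sweedler K (\<lambda>z\<^sub>1 z\<^sub>2.
             R x\<^sub>1 (\<alpha> y\<^sub>1) \<otimes>\<^bsub>K\<^esub> R x\<^sub>2 (\<alpha> z\<^sub>1) \<otimes>\<^bsub>K\<^esub> R y\<^sub>2 z\<^sub>2) (\<Delta> z)) (\<Delta> y)) (\<Delta> x)
         = scalar_sweedler K (\<lambda>x\<^sub>1 x\<^sub>2. scalar_sweedler K (\<lambda>y\<^sub>1 y\<^sub>2. scalar_sweedler K (\<lambda>z\<^sub>1 z\<^sub>2.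
             R y\<^sub>1 z\<^sub>1 \<otimes>\<^bsub>K\<^esub> R x\<^sub>1 (\<alpha> z\<^sub>2) \<otimes>\<^bsub>K\<^esub> R x\<^sub>2 (\<alpha> y\<^sub>2)) (\<Delta> z)) (\<Delta> y)) (\<Delta> x)
       \<and> scalar_sweedler K (\<lambda>x\<^sub>1 x\<^sub>2. scalar_sweedler K (\<lambda>y\<^sub>1 y\<^sub>2. scalar_sweedler K (\<lambda>z\<^sub>1 z\<^sub>2.
             R x\<^sub>1 y\<^sub>1 \<otimes>\<^bsub>K\<^esub> R (\<alpha> x\<^sub>2) z\<^sub>1 \<otimes>\<^bsub>K\<^esub> R (\<alpha> y\<^sub>2) z\<^sub>2) (\<Delta> z)) (\<Delta> y)) (\<Delta> x)
         = scalar_sweedler K (\<lambda>x\<^sub>1 x\<^sub>2. scalar_sweedler K (\<lambda>y\<^sub>1 y\<^sub>2. scalar_sweedler K (\<lambda>z\<^sub>1 z\<^sub>2.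
             R (\<alpha> y\<^sub>1) z\<^sub>1 \<otimes>\<^bsub>K\<^esub> R (\<alpha> x\<^sub>1) z\<^sub>2 \<otimes>\<^bsub>K\<^esub> R x\<^sub>2 y\<^sub>2) (\<Delta> z)) (\<Delta> y)) (\<Delta> x)"
  using cobraided_hom_bialgebra.yang_baxter_from_R_mu_right[OF assms(2-5)]
    cobraided_hom_bialgebra.yang_baxter_from_R_mu_left[OF assms(2-5)]
  by (rule conjI)

end
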